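(* Let $Q(\mathbf{Z})\leftarrow R_1(\mathbf{Z}_1)\Join\dots\Join R_k(\mathbf{Z}_k)$ be a full conjunctive query, and let $CB_{\mathrm{Comb}}(Q,\mathbf{PC})$ be the extension to sets $\mathbf{PC}$ of partition constraints (on the relations of $Q$) of the combinatorics bound $CB_{\mathrm{Comb}}$. Then $$CB_{\mathrm{Comb}}(Q,\mathbf{PC})=O\Big(\max_{I\vDash\mathbf{PC}}|Q^I|\Big),$$ where the hidden constant depends only on the query $Q$.
   Context: A (full) conjunctive query is $Q(\mathbf{Z})\leftarrow R_1(\mathbf{Z}_1)\Join\dots\Join R_k(\mathbf{Z}_k)$ with $\mathbf{Z}=\bigcup_i\mathbf{Z}_i$, where $R_i$ is a relation over the variables $\mathbf{Z}_i$. A database instance $I$ gives a concrete finite set of tuples for each $R_i$; $Q^I$ is the natural join of these. $\pi,\sigma$ denote projection and selection. Degree constraint: for a relation $R(\mathbf{Z}')$ and $\mathbf{X}\subseteq\mathbf{Y}\subseteq\mathbf{Z}'$, $DC_R(\mathbf{X},\mathbf{Y},d)$ asserts $\max_{\mathbf{x}}|\pi_{\mathbf{Y}}\sigma_{\mathbf{X}=\mathbf{x}}R|\le d$ (maximum over all assignments $\mathbf{x}$ of values to $\mathbf{X}$); $DC_R(\mathbf{X},\mathbf{Y})$ is the least such $d$. Partition constraint: for $\mathbf{Y}\subseteq\mathbf{Z}'$ and $\mathcal{X}\subseteq 2^{\mathbf{Y}}$, $PC_R(\mathcal{X},\mathbf{Y},d)$ asserts $\min_{(R^{\mathbf{X}})_{\mathbf{X}\in\mathcal{X}}}\max_{\mathbf{X}\in\mathcal{X}}DC_{R^{\mathbf{X}}}(\mathbf{X},\mathbf{Y})\le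 d$, the minimum being over all families of pairwise disjoint (possibly empty) subrelations with union $R$. $I\vDash\mathbf{DC}$ (resp. $I\vDash\mathbf{PC}$) means $I$ satisfies all constraints in the set. Combinatorics bound: $CB_{\mathrm{Comb}}(Q,\mathbf{DC})=\sup_{I\vDash\mathbf{DC}}|Q^I|$ for a set $\mathbf{DC}$ of degree constraints. Its extension to $\mathbf{PC}=\{PC_{P_i}(\mathcal{X}_i,\mathbf{Y}_i,d_i)\mid i=1,\dots,l\}$ (each $P_i\in\{R_1,\dots,R_k\}$) is $$CB_{\mathrm{Comb}}(Q,\mathbf{PC}):=\sum_{\mathbf{X}^1\in\mathcal{X}_1,\dots,\mathbf{X}^l\in\mathcal{X}_l}CB_{\mathrm{Comb}}\big(Q,\{DC_{P_1}(\mathbf{X}^1,\mathbf{Y}_1,d_1),\dots,DC_{P_l}(\mathbf{X}^l,\mathbf{Y}_l,d_l)\}\big).$$ Standing assumptions: every variable in the query is covered by at least one cardinality constraint (a constraint $DC_R(\emptyset,\mathbf{Z}',d)$ for a relation $R(\mathbf{Z}')$, identified with $PC_R(\{\emptyset\},\mathbf{Z}',d)$), so bounds are finite; and $\mathbf{PC}$ contains, for each relation $R$, at most one partition constraint per pair $(\mathcal{X},\mathbf{Y})$. *)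

theory Defs
  imports Main "HOL-Library.FuncSet" "HOL-Library.Disjoint_Sets" "HOL-Library.Extended_Nat"
begin

text \<open>
  A full conjunctive query is the list of the variable sets of its relations; relation \<open>i\<close> is
  the one at position \<open>i\<close> of the list. Distinct positions carry distinct relations, even when
  their variable sets agree. A tuple over a variable set \<open>Z\<close> is a partial map with domain
  exactly \<open>Z\<close>, with values in an arbitrary type \<open>'a\<close>.
\<close>

type_synonym 'v query = "'v set list"
type_synonym ('v, 'a) tuple = "'v \<rightharpoonup> 'a"
type_synonym ('v, 'a) instance_of = "nat \<Rightarrow> ('v, 'a) tuple set"

definition wf_query :: "'v query \<Rightarrow> bool" where
  "wf_query Q \<longleftrightarrow> (\<forall>Z\<in>set Q. finite Z)"

definition query_vars :: "'v query \<Rightarrow> 'v set" where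
  "query_vars Q = \<Union>(set Q)"

definition is_instance :: "'v query \<Rightarrow> ('v, 'a) instance_of \<Rightarrow> bool" where
  "is_instance Q I \<longleftrightarrow> (\<forall>i<length Q. finite (I i) \<and> (\<forall>t\<in>I i. dom t = Q ! i))"

definition project :: "'v set \<Rightarrow> ('v, 'a) tuple set \<Rightarrow> ('v, 'a) tuple set" where
  "project Y R = (\<lambda>t. t |` Y) ` R"

definition select :: "'v set \<Rightarrow> ('v, 'a) tuple \<Rightarrow> ('v, 'a) tuple set \<Rightarrow> ('v, 'a) tuple set" where
  "select X x R = {t \<in> R. t |` X = x}"

definition query_output :: "'v query \<Rightarrow> ('v, 'a) instance_of \<Rightarrow> ('v, 'a) tuple set" where
  "query_output Q I = {t. dom t = query_vars Q \<and> (\<forall>i<length Q. t |` (Q ! i) \<in> I i)}"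

text \<open>
  Degrees and bounds take values in \<^typ>\<open>enat\<close>, so that every supremum and infimum is
  meaningful. For finite \<open>R\<close> the supremum in \<open>degree\<close> is a maximum. The infimum in
  \<open>partition_degree\<close> is attained whenever an admissible family exists; it is \<open>\<infinity>\<close>
  only when none does, i.e. when \<open>\<X>\<close> is empty and \<open>R\<close> is not.
\<close>

definition degree :: "('v, 'a) tuple set \<Rightarrow> 'v set \<Rightarrow> 'v set \<Rightarrow> enat" where
  "degree R X Y = (SUP x\<in>{x. dom x = X}. enat (card (project Y (select X x R))))"

definition partitions ::
  "('v, 'a) tuple set \<Rightarrow> 'v set set \<Rightarrow> ('v set \<Rightarrow> ('v, 'a) tuple set) set" where
  "partitions R \<X> = {F. disjoint_family_on F \<X> \<and> (\<Union>X\<in>\<X>. F X) = R}"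

definition partition_degree :: "('v, 'a) tuple set \<Rightarrow> 'v set set \<Rightarrow> 'v set \<Rightarrow> enat" where
  "partition_degree R \<X> Y = (INF F\<in>partitions R \<X>. SUP X\<in>\<X>. degree (F X) X Y)"

text \<open>\<open>DC P X Y d\<close> and \<open>PC P \<X> Y d\<close> constrain the relation at position \<open>P\<close>.\<close>

datatype 'v degree_constraint = DC nat "'v set" "'v set" nat

datatype 'v partition_constraint =
  PC (pc_rel: nat) (pc_parts: "'v set set") (pc_attrs: "'v set") (pc_bound: nat)

fun sat_dc :: "('v, 'a) instance_of \<Rightarrow> 'v degree_constraint \<Rightarrow> bool" where
  "sat_dc I (DC P X Y d) \<longleftrightarrow> degree (I P) X Y \<le> enat d"

fun sat_pc :: "('v, 'a) instance_of \<Rightarrow> 'v partition_constraint \<Rightarrow> bool" where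
  "sat_pc I (PC P \<X> Y d) \<longleftrightarrow> partition_degree (I P) \<X> Y \<le> enat d"

definition dc_models :: "'v query \<Rightarrow> 'v degree_constraint set \<Rightarrow> ('v, 'a) instance_of set" where
  "dc_models Q DCs = {I. is_instance Q I \<and> (\<forall>c\<in>DCs. sat_dc I c)}"

definition pc_models :: "'v query \<Rightarrow> 'v partition_constraint set \<Rightarrow> ('v, 'a) instance_of set" where
  "pc_models Q PCs = {I. is_instance Q I \<and> (\<forall>c\<in>PCs. sat_pc I c)}"

text \<open>
  The last conjunct says that no two constraints differ only in their bound; since variable
  sets are finite, it makes every well-formed set of constraints finite.
\<close>

definition wf_pcs :: "'v query \<Rightarrow> 'v partition_constraint set \<Rightarrow> bool" where
  "wf_pcs Q PCs \<longleftrightarrow>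
     (\<forall>c\<in>PCs. pc_rel c < length Q \<and> pc_attrs c \<subseteq> Q ! pc_rel c \<and> pc_parts c \<subseteq> Pow (pc_attrs c)) \<and>
     (\<forall>c\<in>PCs. \<forall>c'\<in>PCs.
        pc_rel c = pc_rel c' \<and> pc_parts c = pc_parts c' \<and> pc_attrs c = pc_attrs c' \<longrightarrow> c = c')"

text \<open>A cardinality constraint on relation \<open>i\<close> is a partition constraint with \<open>\<X> = {{}}\<close>.\<close>

definition all_vars_covered :: "'v query \<Rightarrow> 'v partition_constraint set \<Rightarrow> bool" where
  "all_vars_covered Q PCs \<longleftrightarrow>
     (\<forall>v\<in>query_vars Q. \<exists>i<length Q. v \<in> Q ! i \<and> (\<exists>d. PC i {{}} (Q ! i) d \<in> PCs))"

text \<open>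
  The bounds depend on the type of values through the instances, hence the \<^typ>\<open>'a itself\<close>
  argument. In \<open>CB_comb_pc\<close> the function \<open>f\<close> chooses one \<open>X \<in> \<X>\<close> for each constraint.
\<close>

definition CB_comb :: "'a itself \<Rightarrow> 'v query \<Rightarrow> 'v degree_constraint set \<Rightarrow> enat" where
  "CB_comb _ Q DCs =
     (SUP I\<in>(dc_models Q DCs :: ('v, 'a) instance_of set). enat (card (query_output Q I)))"

definition CB_comb_pc :: "'a itself \<Rightarrow> 'v query \<Rightarrow> 'v partition_constraint set \<Rightarrow> enat" where
  "CB_comb_pc T Q PCs =
     (\<Sum>f\<in>(\<Pi>\<^sub>E c\<in>PCs. pc_parts c).
        CB_comb T Q ((\<lambda>c. DC (pc_rel c) (f c) (pc_attrs c) (pc_bound c)) ` PCs))"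

definition output_sizes :: "'a itself \<Rightarrow> 'v query \<Rightarrow> 'v partition_constraint set \<Rightarrow> nat set" where
  "output_sizes _ Q PCs =
     (\<lambda>I. card (query_output Q I)) ` (pc_models Q PCs :: ('v, 'a) instance_of set)"

text \<open>
  The set of output sizes is finite and nonempty, so that it has a genuine maximum.
\<close>

lemma card_le_cardinality_constraint:
  assumes "is_instance Q I" "i < length Q" "sat_pc I (PC i {{}} (Q ! i) d)"
  shows "card (I i) \<le> d"
proof -
  have dom: "dom t = Q ! i" if "t \<in> I i" for t
    using assms(1,2) that by (auto simp: is_instance_def)
  have sel: "select {} Map.empty (I i) = I i"
    by (auto simp: select_def restrict_map_def)
  have proj: "project (Q ! i) (I i) = I i"
  proof -
    have "t |` (Q ! i) = t" if "t \<in> I i" for t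
    proof
      fix v
      show "(t |` (Q ! i)) v = t v"
        using dom[OF that] by (metis domIff restrict_in restrict_out)
    qed
    then show ?thesis by (auto simp: project_def image_iff)
  qed
  have deg: "enat (card (I i)) \<le> degree (I i) {} (Q ! i)"
    unfolding degree_def by (rule SUP_upper2[of Map.empty]) (simp_all add: sel proj)
  have "enat (card (I i)) \<le> partition_degree (I i) {{}} (Q ! i)"
    unfolding partition_degree_def using deg by (intro INF_greatest) (auto simp: partitions_def)
  also have "\<dots> \<le> enat d" using assms(3) by simp
  finally show ?thesis by simp
qed

lemma finite_output_sizes:
  fixes Q :: "'v query"
  assumes "all_vars_covered Q PCs"
  shows "finite (output_sizes TYPE('a) Q PCs)"
proof -
  define S where "S = {i. i < length Q \<and> (\<exists>d. PC i {{}} (Q ! i) d \<in> PCs)}"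
  have "\<forall>i\<in>S. \<exists>d. PC i {{}} (Q ! i) d \<in> PCs" by (simp add: S_def)
  then obtain D where D: "\<And>i. i \<in> S \<Longrightarrow> PC i {{}} (Q ! i) (D i) \<in> PCs" by metis
  have finS: "finite S" by (simp add: S_def)
  have "card (query_output Q I) \<le> (\<Prod>i\<in>S. D i)"
    if I: "I \<in> pc_models Q PCs" for I :: "('v, 'a) instance_of"
  proof -
    have inst: "is_instance Q I" using I by (simp add: pc_models_def)
    let ?h = "\<lambda>t. \<lambda>i\<in>S. t |` (Q ! i)"
    have finP: "finite (Pi\<^sub>E S I)"
      using inst finS by (intro finite_PiE) (auto simp: is_instance_def S_def)
    have sub: "?h ` query_output Q I \<subseteq> Pi\<^sub>E S I"
      by (auto simp: query_output_def S_def)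
    have inj: "inj_on ?h (query_output Q I)"
    proof (rule inj_onI)
      fix s t assume st: "s \<in> query_output Q I" "t \<in> query_output Q I" "?h s = ?h t"
      show "s = t"
      proof
        fix v
        show "s v = t v"
        proof (cases "v \<in> query_vars Q")
          case True
          then obtain i where i: "i \<in> S" "v \<in> Q ! i"
            using assms unfolding all_vars_covered_def S_def by blast
          then have "s |` (Q ! i) = t |` (Q ! i)"
            using fun_cong[OF st(3), of i] by simp
          then show ?thesis using i(2) by (metis restrict_in)
        next
          case False
          moreover have "dom s = query_vars Q" "dom t = query_vars Q"
            using st(1,2) by (auto simp: query_output_def)
          ultimately show ?thesis by (metis domIff)
        qed
      qed
    qed
    have "card (query_output Q I) \<le> card (Pi\<^sub>E S I)"
      by (rule card_inj_on_le[OF inj sub finP])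
    also have "\<dots> = (\<Prod>i\<in>S. card (I i))" by (rule card_PiE[OF finS])
    also have "\<dots> \<le> (\<Prod>i\<in>S. D i)"
    proof (rule prod_mono, intro conjI)
      fix i assume i: "i \<in> S"
      have "sat_pc I (PC i {{}} (Q ! i) (D i))"
        using I D[OF i] by (auto simp: pc_models_def)
      with i show "card (I i) \<le> D i"
        by (intro card_le_cardinality_constraint[OF inst]) (auto simp: S_def)
    qed simp
    finally show ?thesis .
  qed
  then have "output_sizes TYPE('a) Q PCs \<subseteq> {..(\<Prod>i\<in>S. D i)}"
    by (auto simp: output_sizes_def)
  then show ?thesis by (rule finite_subset) simp
qed

lemma output_sizes_nonempty:
  fixes Q :: "'v query"
  shows "output_sizes TYPE('a) Q PCs \<noteq> {}"
proof -
  have "sat_pc ((\<lambda>_. {}) :: ('v, 'a) instance_of) c" for c :: "'v partition_constraint"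
  proof (cases c)
    case (PC P \<X> Y d)
    have "partition_degree ({} :: ('v, 'a) tuple set) \<X> Y \<le> (SUP X\<in>\<X>. degree ({} :: ('v, 'a) tuple set) X Y)"
      unfolding partition_degree_def
      by (rule INF_lower2[of "\<lambda>_. {}"]) (auto simp: partitions_def disjoint_family_on_def)
    also have "\<dots> \<le> 0"
      by (intro SUP_least) (auto simp: degree_def select_def project_def zero_enat_def intro: SUP_least)
    also have "(0::enat) \<le> enat d" by simp
    finally show ?thesis using PC by simp
  qed
  then have "(\<lambda>_. {}) \<in> (pc_models Q PCs :: ('v, 'a) instance_of set)"
    by (simp add: pc_models_def is_instance_def)
  then show ?thesis by (auto simp: output_sizes_def)
qed

end

(* An instance satisfying the degree constraints chosen by f satisfies every partition constraint
   via the trivial partition that puts the whole relation into the chosen part. So each summand of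
   the bound is at most the maximum, and the number of summands depends on the query only. *)
theory Submission
  imports Defs
begin

lemma degree_empty [simp]: "degree {} X Y = 0"
  by (simp add: degree_def select_def project_def zero_enat_def [symmetric] bot_enat_def [symmetric])

lemma partition_degree_le_degree:
  assumes "X \<in> \<X>"
  shows "partition_degree R \<X> Y \<le> degree R X Y"
proof -
  let ?F = "\<lambda>X'. if X' = X then R else {}"
  have "?F \<in> partitions R \<X>"
    using assms by (auto simp: partitions_def disjoint_family_on_def)
  then have "partition_degree R \<X> Y \<le> (SUP X'\<in>\<X>. degree (?F X') X' Y)"
    unfolding partition_degree_def by (rule INF_lower)
  also have "\<dots> \<le> degree R X Y"
    \<comment> \<open>The part at \<open>X\<close> contributes \<open>degree R X Y\<close> itself.
      Every other part is empty and contributes 0 by \<open>degree_empty\<close>.\<close>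
    by (rule SUP_least) auto
  finally show ?thesis .
qed

text \<open>The constraints can be treated one at a time: \<open>f c\<close> is a member of
  \<open>pc_parts c\<close>, so a degree bound at \<open>f c\<close> also bounds the minimum over
  all partitions.\<close>

lemma dc_models_subset_pc_models:
  assumes "f \<in> (\<Pi>\<^sub>E c\<in>PCs. pc_parts c)"
  shows "dc_models Q ((\<lambda>c. DC (pc_rel c) (f c) (pc_attrs c) (pc_bound c)) ` PCs)
           \<subseteq> pc_models Q PCs"
proof -
  have "sat_pc I c"
    if "c \<in> PCs" "sat_dc I (DC (pc_rel c) (f c) (pc_attrs c) (pc_bound c))" for I c
  proof -
    have "f c \<in> pc_parts c"
      using assms that(1) by auto
    from partition_degree_le_degree[OF this] that(2) show ?thesis
      by (cases c) (auto intro: order_trans)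
  qed
  then show ?thesis
    by (auto simp: dc_models_def pc_models_def)
qed

lemma CB_comb_le_Max_output_sizes:
  fixes Q :: "'v query"
  assumes "all_vars_covered Q PCs" and "f \<in> (\<Pi>\<^sub>E c\<in>PCs. pc_parts c)"
  shows "CB_comb TYPE('a) Q ((\<lambda>c. DC (pc_rel c) (f c) (pc_attrs c) (pc_bound c)) ` PCs)
           \<le> enat (Max (output_sizes TYPE('a) Q PCs))"
  unfolding CB_comb_def
proof (rule SUP_least)
  fix I :: "('v, 'a) instance_of"
  assume "I \<in> dc_models Q ((\<lambda>c. DC (pc_rel c) (f c) (pc_attrs c) (pc_bound c)) ` PCs)"
  then have "card (query_output Q I) \<in> output_sizes TYPE('a) Q PCs"
    using dc_models_subset_pc_models[OF assms(2)] by (auto simp: output_sizes_def)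
  \<comment> \<open>Coverage of the variables makes the set of output sizes finite, so its
    \<open>Max\<close> is an upper bound of each member.\<close>
  then show "enat (card (query_output Q I)) \<le> enat (Max (output_sizes TYPE('a) Q PCs))"
    using finite_output_sizes[OF assms(1), where ?'a = 'a] by simp
qed

lemma finite_query_vars: "wf_query Q \<Longrightarrow> finite (query_vars Q)"
  by (auto simp: wf_query_def query_vars_def)

text \<open>Passing from the attributes of a single relation to \<open>query_vars Q\<close> gives
  all constraints a common ground set, over which they can be counted together.\<close>

lemma wf_pcs_parts_subset:
  assumes "wf_pcs Q PCs" "c \<in> PCs"
  shows "pc_rel c < length Q" "pc_attrs c \<subseteq> query_vars Q" "pc_parts c \<subseteq> Pow (query_vars Q)"
proof -
  have *: "pc_rel c < length Q" "pc_attrs c \<subseteq> Q ! pc_rel c" "pc_parts c \<subseteq> Pow (pc_attrs c)"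
    using assms by (auto simp: wf_pcs_def)
  then have "Q ! pc_rel c \<subseteq> query_vars Q"
    by (auto simp: query_vars_def intro: nth_mem)
  with * show "pc_rel c < length Q" "pc_attrs c \<subseteq> query_vars Q"
    "pc_parts c \<subseteq> Pow (query_vars Q)"
    by blast+
qed

text \<open>The numeric bounds range over an infinite set, but in a well-formed set a constraint is
  determined by its other three components. These range over a finite set fixed by
  \<open>Q\<close>.\<close>

lemma card_wf_pcs_le:
  assumes "wf_query Q" "wf_pcs Q PCs"
  defines "V \<equiv> query_vars Q"
  shows "finite PCs \<and> card PCs \<le> card ({..<length Q} \<times> Pow (Pow V) \<times> Pow V)"
proof -
  let ?h = "\<lambda>c. (pc_rel c, pc_parts c, pc_attrs c)"
  have inj: "inj_on ?h PCs"
    using assms(2) by (auto simp: inj_on_def wf_pcs_def)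
  have sub: "?h ` PCs \<subseteq> {..<length Q} \<times> Pow (Pow V) \<times> Pow V"
    using wf_pcs_parts_subset[OF assms(2)] by (fastforce simp: V_def)
  have fin: "finite ({..<length Q} \<times> Pow (Pow V) \<times> Pow V)"
    using finite_query_vars[OF assms(1)] by (simp add: V_def)
  from inj_on_finite[OF inj sub fin] card_inj_on_le[OF inj sub fin] show ?thesis
    by blast
qed

text \<open>This counts the summands of \<open>CB_comb_pc\<close>: each constraint offers at most
  \<open>2 ^ card V\<close> choices, and the number of constraints is bounded in terms of
  \<open>Q\<close>.\<close>

lemma card_choices_le:
  assumes "wf_query Q" "wf_pcs Q PCs"
  defines "V \<equiv> query_vars Q"
  shows "card (\<Pi>\<^sub>E c\<in>PCs. pc_parts c)
           \<le> (2 ^ card V) ^ card ({..<length Q} \<times> Pow (Pow V) \<times> Pow V)"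
proof -
  have finV: "finite V"
    using finite_query_vars[OF assms(1)] by (simp add: V_def)
  have "card (\<Pi>\<^sub>E c\<in>PCs. pc_parts c) = (\<Prod>c\<in>PCs. card (pc_parts c))"
    using card_wf_pcs_le[OF assms(1,2)] by (intro card_PiE) blast
  also have "\<dots> \<le> (\<Prod>c\<in>PCs. 2 ^ card V)"
  proof (intro prod_mono conjI)
    fix c assume "c \<in> PCs"
    then have "card (pc_parts c) \<le> card (Pow V)"
      using wf_pcs_parts_subset(3)[OF assms(2)] finV by (intro card_mono) (auto simp: V_def)
    then show "card (pc_parts c) \<le> 2 ^ card V"
      using finV by (simp add: card_Pow)
  qed simp
  also have "\<dots> = (2 ^ card V) ^ card PCs"
    by simp
  \<comment> \<open>Enlarging the exponent is sound because the base is at least 1, even for empty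
    \<open>V\<close>.\<close>
  also have "\<dots> \<le> (2 ^ card V) ^ card ({..<length Q} \<times> Pow (Pow V) \<times> Pow V)"
    using card_wf_pcs_le[OF assms(1,2)] by (intro power_increasing) (simp_all add: V_def)
  finally show ?thesis .
qed

theorem proposition19:
  fixes Q :: "'v query"
  assumes "wf_query Q"
  shows "\<exists>C::nat. \<forall>PCs. wf_pcs Q PCs \<and> all_vars_covered Q PCs \<longrightarrow>
           CB_comb_pc TYPE('a) Q PCs \<le> enat (C * Max (output_sizes TYPE('a) Q PCs))"
proof -
  let ?V = "query_vars Q"
  \<comment> \<open>The constant is fixed before \<open>PCs\<close> and is built from
    \<open>length Q\<close> and \<open>query_vars Q\<close> alone.\<close>
  let ?C = "(2 ^ card ?V) ^ card ({..<length Q} \<times> Pow (Pow ?V) \<times> Pow ?V) :: nat"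
  have "CB_comb_pc TYPE('a) Q PCs \<le> enat (?C * Max (output_sizes TYPE('a) Q PCs))"
    if wf: "wf_pcs Q PCs" and cov: "all_vars_covered Q PCs" for PCs
  proof -
    let ?M = "Max (output_sizes TYPE('a) Q PCs)"
    let ?F = "\<Pi>\<^sub>E c\<in>PCs. pc_parts c"
    \<comment> \<open>If some constraint has no parts, \<open>?F\<close> is empty and both sums are
      0.\<close>
    have "CB_comb_pc TYPE('a) Q PCs \<le> (\<Sum>f\<in>?F. enat ?M)"
      unfolding CB_comb_pc_def by (intro sum_mono CB_comb_le_Max_output_sizes[OF cov])
    also have "\<dots> = enat (card ?F * ?M)"
      by (simp add: of_nat_eq_enat)
    also have "\<dots> \<le> enat (?C * ?M)"
      using mult_le_mono1[OF card_choices_le[OF assms wf]] by simp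
    finally show ?thesis .
  qed
  then show ?thesis
    by blast
qed

end
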